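(* Let $X$ be a finite non-empty set, let $f,g:X\to X$ be bijections with $fg=gf$, and let $S:X\times X\to X\times X$ be given by $S(x,y)=(g(y),f(x))$ (a not necessarily involutive permutation solution). Let $G$ be the structure group of $(X,S)$. Then $G$ is a Garside group.
   Context: The structure group of $(X,S)$ is the group generated by the elements of $X$ with defining relations $xy=tz$ whenever $S(x,y)=(t,z)$. Garside groups. In a monoid, $x$ is a left (resp. right) divisor of $z$ if $z=xt$ (resp. $z=tx$) for some $t$. A right lcm of $x,y$ is an element having $x,y$ as left divisors that is a left divisor of every element having $x,y$ as left divisors; a left gcd is a common left divisor that every common left divisor left-divides; left lcm and right gcd are defined symmetrically. An atom is an $x\neq1$ such that $x=yz$ implies $y=1$ or $z=1$. A monoid is atomic if it is generated by its atoms and each element has a finite supremum of lengths of decompositions into atoms. It is Gaussian if it is atomic, left and right cancellative, and any two elements have left and right gcds and lcms. A Garside element is an element whose left divisors coincide with its right divisors, are finite in number, and generate the monoid. A Garside monoid is a Gaussian monoid containing a Garside element, and a Garside group is the group of fractions of a Garside monoid. *)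

theory Defs
  imports "HOL-Algebra.Divisibility"
begin

section \<open>Groups given by generators and relations\<close>

text \<open>
  Group words over \<^term>\<open>X\<close> are lists of signed letters: \<^term>\<open>(x, True)\<close> stands for the
  generator \<^term>\<open>x\<close> and \<^term>\<open>(x, False)\<close> for its formal inverse.
\<close>

type_synonym 'a gword = "('a \<times> bool) list"

definition gwords :: "'a set \<Rightarrow> 'a gword set"
  where "gwords X = lists (X \<times> UNIV)"

inductive_set word_rel :: "'a set \<Rightarrow> ('a gword \<times> 'a gword) set \<Rightarrow> ('a gword \<times> 'a gword) set"
  for X :: "'a set" and R :: "('a gword \<times> 'a gword) set"
where
  refl: "w \<in> gwords X \<Longrightarrow> (w, w) \<in> word_rel X R"
| sym: "(u, v) \<in> word_rel X R \<Longrightarrow> (v, u) \<in> word_rel X R"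
| trans: "(u, v) \<in> word_rel X R \<Longrightarrow> (v, w) \<in> word_rel X R \<Longrightarrow> (u, w) \<in> word_rel X R"
| cancel: "u \<in> gwords X \<Longrightarrow> v \<in> gwords X \<Longrightarrow> x \<in> X
    \<Longrightarrow> (u @ [(x, b), (x, \<not> b)] @ v, u @ v) \<in> word_rel X R"
| relation: "u \<in> gwords X \<Longrightarrow> v \<in> gwords X \<Longrightarrow> r \<in> gwords X \<Longrightarrow> s \<in> gwords X \<Longrightarrow> (r, s) \<in> R
    \<Longrightarrow> (u @ r @ v, u @ s @ v) \<in> word_rel X R"

definition presented_group :: "'a set \<Rightarrow> ('a gword \<times> 'a gword) set \<Rightarrow> 'a gword set monoid"
  where "presented_group X R =
    \<lparr> carrier = gwords X // word_rel X R,
      mult = (\<lambda>A B. word_rel X R `` {a @ b | a b. a \<in> A \<and> b \<in> B}),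
      one = word_rel X R `` {[]} \<rparr>"

definition structure_group :: "'a set \<Rightarrow> ('a \<times> 'a \<Rightarrow> 'a \<times> 'a) \<Rightarrow> 'a gword set monoid"
  where "structure_group X S = presented_group X
    {([(x, True), (y, True)], [(t, True), (z, True)]) | x y t z.
       x \<in> X \<and> y \<in> X \<and> S (x, y) = (t, z)}"


section \<open>Garside monoids and Garside groups\<close>

definition left_divisor :: "('a, 'm) monoid_scheme \<Rightarrow> 'a \<Rightarrow> 'a \<Rightarrow> bool"
  where "left_divisor M x z \<longleftrightarrow> (\<exists>t\<in>carrier M. z = x \<otimes>\<^bsub>M\<^esub> t)"

definition right_divisor :: "('a, 'm) monoid_scheme \<Rightarrow> 'a \<Rightarrow> 'a \<Rightarrow> bool"
  where "right_divisor M x z \<longleftrightarrow> (\<exists>t\<in>carrier M. z = t \<otimes>\<^bsub>M\<^esub> x)"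

text \<open>Note the convention: right lcms refer to left divisors, left lcms to right divisors.\<close>

definition is_right_lcm :: "('a, 'm) monoid_scheme \<Rightarrow> 'a \<Rightarrow> 'a \<Rightarrow> 'a \<Rightarrow> bool"
  where "is_right_lcm M m x y \<longleftrightarrow>
    m \<in> carrier M \<and> left_divisor M x m \<and> left_divisor M y m \<and>
    (\<forall>n\<in>carrier M. left_divisor M x n \<and> left_divisor M y n \<longrightarrow> left_divisor M m n)"

definition is_left_lcm :: "('a, 'm) monoid_scheme \<Rightarrow> 'a \<Rightarrow> 'a \<Rightarrow> 'a \<Rightarrow> bool"
  where "is_left_lcm M m x y \<longleftrightarrow>
    m \<in> carrier M \<and> right_divisor M x m \<and> right_divisor M y m \<and>
    (\<forall>n\<in>carrier M. right_divisor M x n \<and> right_divisor M y n \<longrightarrow> right_divisor M m n)"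

definition is_left_gcd :: "('a, 'm) monoid_scheme \<Rightarrow> 'a \<Rightarrow> 'a \<Rightarrow> 'a \<Rightarrow> bool"
  where "is_left_gcd M d x y \<longleftrightarrow>
    d \<in> carrier M \<and> left_divisor M d x \<and> left_divisor M d y \<and>
    (\<forall>e\<in>carrier M. left_divisor M e x \<and> left_divisor M e y \<longrightarrow> left_divisor M e d)"

definition is_right_gcd :: "('a, 'm) monoid_scheme \<Rightarrow> 'a \<Rightarrow> 'a \<Rightarrow> 'a \<Rightarrow> bool"
  where "is_right_gcd M d x y \<longleftrightarrow>
    d \<in> carrier M \<and> right_divisor M d x \<and> right_divisor M d y \<and>
    (\<forall>e\<in>carrier M. right_divisor M e x \<and> right_divisor M e y \<longrightarrow> right_divisor M e d)"

definition list_prod :: "('a, 'm) monoid_scheme \<Rightarrow> 'a list \<Rightarrow> 'a"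
  where "list_prod M xs = foldr (mult M) xs (one M)"

definition monoid_generated_by :: "('a, 'm) monoid_scheme \<Rightarrow> 'a set \<Rightarrow> bool"
  where "monoid_generated_by M A \<longleftrightarrow>
    A \<subseteq> carrier M \<and> (\<forall>z\<in>carrier M. \<exists>xs. set xs \<subseteq> A \<and> list_prod M xs = z)"

definition atoms :: "('a, 'm) monoid_scheme \<Rightarrow> 'a set"
  where "atoms M = {x \<in> carrier M. x \<noteq> \<one>\<^bsub>M\<^esub> \<and>
    (\<forall>y\<in>carrier M. \<forall>z\<in>carrier M. x = y \<otimes>\<^bsub>M\<^esub> z \<longrightarrow> y = \<one>\<^bsub>M\<^esub> \<or> z = \<one>\<^bsub>M\<^esub>)}"

definition atomic_monoid :: "('a, 'm) monoid_scheme \<Rightarrow> bool"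
  where "atomic_monoid M \<longleftrightarrow> monoid M \<and> monoid_generated_by M (atoms M) \<and>
    (\<forall>z\<in>carrier M. bdd_above {length xs | xs. set xs \<subseteq> atoms M \<and> list_prod M xs = z})"

definition gaussian_monoid :: "('a, 'm) monoid_scheme \<Rightarrow> bool"
  where "gaussian_monoid M \<longleftrightarrow> atomic_monoid M \<and> monoid_cancel M \<and>
    (\<forall>x\<in>carrier M. \<forall>y\<in>carrier M.
       (\<exists>d. is_left_gcd M d x y) \<and> (\<exists>d. is_right_gcd M d x y) \<and>
       (\<exists>m. is_left_lcm M m x y) \<and> (\<exists>m. is_right_lcm M m x y))"

definition garside_element :: "('a, 'm) monoid_scheme \<Rightarrow> 'a \<Rightarrow> bool"
  where "garside_element M \<Delta> \<longleftrightarrow> \<Delta> \<in> carrier M \<and>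
    {x \<in> carrier M. left_divisor M x \<Delta>} = {x \<in> carrier M. right_divisor M x \<Delta>} \<and>
    finite {x \<in> carrier M. left_divisor M x \<Delta>} \<and>
    monoid_generated_by M {x \<in> carrier M. left_divisor M x \<Delta>}"

definition garside_monoid :: "('a, 'm) monoid_scheme \<Rightarrow> bool"
  where "garside_monoid M \<longleftrightarrow> gaussian_monoid M \<and> (\<exists>\<Delta>. garside_element M \<Delta>)"

text \<open>
  \<^term>\<open>G\<close> is the group of (left) fractions of \<^term>\<open>M\<close> via the embedding \<^term>\<open>\<iota>\<close>. If any two
  elements of \<^term>\<open>M\<close> have common left and right multiples, as in every Gaussian monoid, the
  same elements are also right fractions, and \<^term>\<open>G\<close> is unique up to isomorphism. A map in
  \<^term>\<open>hom M G\<close> preserves the unit because \<^term>\<open>G\<close> is a group.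
\<close>

definition group_of_fractions ::
    "('a, 'm) monoid_scheme \<Rightarrow> ('b, 'n) monoid_scheme \<Rightarrow> ('a \<Rightarrow> 'b) \<Rightarrow> bool"
  where "group_of_fractions M G \<iota> \<longleftrightarrow> monoid M \<and> group G \<and> \<iota> \<in> hom M G \<and> inj_on \<iota> (carrier M) \<and>
    (\<forall>z\<in>carrier G. \<exists>a\<in>carrier M. \<exists>b\<in>carrier M. z = inv\<^bsub>G\<^esub> (\<iota> a) \<otimes>\<^bsub>G\<^esub> \<iota> b)"

text \<open>
  The monoid is taken over the element type of \<^term>\<open>G\<close>. This is no restriction: a monoid
  embedded in \<^term>\<open>G\<close> is isomorphic to its image.
\<close>

definition garside_group :: "('a, 'm) monoid_scheme \<Rightarrow> bool"
  where "garside_group G \<longleftrightarrow>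
    (\<exists>(M :: 'a monoid) \<iota>. garside_monoid M \<and> group_of_fractions M G \<iota>)"

end

theory Submission
  imports Defs "HOL-Algebra.Generated_Groups"
begin

text \<open>
  In the structure group \<open>G\<close> the relation \<open>S (g a, a) = (g a, f (g a))\<close> cancels to
  \<open>a = f (g a)\<close>. So if \<open>Y\<close> is the set of elements of \<open>G\<close> named by letters, then \<open>g\<close> and \<open>f\<close>
  induce mutually inverse permutations \<open>\<gamma>\<close> and \<open>\<delta>\<close> of \<open>Y\<close>, and the relations read
  \<open>\<gamma> x \<cdot> y = \<gamma> y \<cdot> x\<close>, which is the involutive case.

  Let each generator \<open>y\<close> act on the functions \<open>u\<close> from \<open>Y\<close> to the integers by
  \<open>u \<mapsto> e\<^sub>y + u \<circ> \<delta>\<close>, where \<open>e\<^sub>y\<close> is the indicator function of \<open>y\<close>. These maps are invertible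
  and respect the relations, so \<open>G\<close> acts; write \<open>\<phi> a\<close> for the image of the zero function under
  \<open>a\<close>. On the submonoid \<open>M\<close> generated by \<open>Y\<close> this is a bijection onto the nonnegative functions
  (\<open>pos_eqI\<close>, \<open>pos_with_coordinates\<close>): any generator that occurs in \<open>\<phi> a\<close> can be moved to the
  front of a word for \<open>a\<close> by the relations. It turns the product of \<open>M\<close> into
  \<open>u * v = u + v \<circ> \<delta>\<^sup>n\<close> with \<open>n\<close> the sum of the values of \<open>u\<close> (\<open>coord_mult\<close>).

  Hence \<open>a\<close> divides \<open>c\<close> on the left iff \<open>\<phi> a \<le> \<phi> c\<close> pointwise (\<open>left_divisor_iff\<close>), and on
  the right iff the same holds after twisting the coordinates of each element by a power of \<open>\<gamma>\<close>
  (\<open>right_divisor_iff\<close>). Both divisibility orders are therefore pointwise orders on nonnegative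
  functions; gcds and lcms are minima and maxima. The element with all coordinates 1 is invariant
  under the twist, so its left and its right divisors are the elements with coordinates at most 1,
  and it is a Garside element. Finally \<open>M\<close> lies in \<open>G\<close> and generates it as a group, and common
  left multiples rewrite \<open>b \<cdot> c\<inverse>\<close> as \<open>s\<inverse> \<cdot> t\<close>, so \<open>G\<close> is the group of left fractions of
  \<open>M\<close>.
\<close>

section \<open>Groups given by a presentation\<close>

lemma word_rel_gwords: "(u, v) \<in> word_rel X R \<Longrightarrow> u \<in> gwords X \<and> v \<in> gwords X"
  by (induction rule: word_rel.induct) (auto simp: gwords_def)

lemma equiv_word_rel: "equiv (gwords X) (word_rel X R)"
  by (rule equivI)
    (auto simp: refl_on_def sym_def trans_def dest: word_rel_gwords
      intro: word_rel.refl word_rel.sym word_rel.trans)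

lemma word_rel_append_context:
  assumes "(u, v) \<in> word_rel X R" "p \<in> gwords X" "q \<in> gwords X"
  shows "(p @ u @ q, p @ v @ q) \<in> word_rel X R"
  using assms(1)
proof induction
  case (refl w)
  then show ?case using assms(2,3) by (intro word_rel.refl) (auto simp: gwords_def)
next
  case (cancel u v x b)
  then show ?case using word_rel.cancel[of "p @ u" X "v @ q" x b R] assms(2,3)
    by (auto simp: gwords_def)
next
  case (relation u v r s)
  then show ?case using word_rel.relation[of "p @ u" X "v @ q" r s R] assms(2,3)
    by (auto simp: gwords_def)
qed (blast intro: word_rel.sym word_rel.trans)+

lemma word_rel_append:
  assumes "(u, u') \<in> word_rel X R" "(v, v') \<in> word_rel X R"
  shows "(u @ v, u' @ v') \<in> word_rel X R"
proof -
  have w: "u' \<in> gwords X" "v \<in> gwords X" "[] \<in> gwords X"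
    using word_rel_gwords[OF assms(1)] word_rel_gwords[OF assms(2)] by (simp_all add: gwords_def)
  have "(u @ v, u' @ v) \<in> word_rel X R"
    using word_rel_append_context[OF assms(1) w(3,2)] by simp
  moreover have "(u' @ v, u' @ v') \<in> word_rel X R"
    using word_rel_append_context[OF assms(2) w(1,3)] by simp
  ultimately show ?thesis by (rule word_rel.trans)
qed

abbreviation word_class :: "'a set \<Rightarrow> ('a gword \<times> 'a gword) set \<Rightarrow> 'a gword \<Rightarrow> 'a gword set"
  where "word_class X R w \<equiv> word_rel X R `` {w}"

lemma word_class_eq_iff:
  "u \<in> gwords X \<Longrightarrow> v \<in> gwords X \<Longrightarrow> word_class X R u = word_class X R v \<longleftrightarrow> (u, v) \<in> word_rel X R"
  using equiv_word_rel by (rule eq_equiv_class_iff)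

lemma word_class_in_carrier: "u \<in> gwords X \<Longrightarrow> word_class X R u \<in> carrier (presented_group X R)"
  by (simp add: presented_group_def quotientI)

lemma carrier_presented_group_cases:
  assumes "a \<in> carrier (presented_group X R)"
  obtains u where "u \<in> gwords X" "a = word_class X R u"
  using assms by (auto simp: presented_group_def elim: quotientE)

lemma one_presented_group: "\<one>\<^bsub>presented_group X R\<^esub> = word_class X R []"
  by (simp add: presented_group_def)

lemma mult_word_class:
  assumes "u \<in> gwords X" "v \<in> gwords X"
  shows "word_class X R u \<otimes>\<^bsub>presented_group X R\<^esub> word_class X R v = word_class X R (u @ v)"
proof -
  have "word_rel X R `` {a @ b | a b. a \<in> word_class X R u \<and> b \<in> word_class X R v}
      = word_class X R (u @ v)"
    using assms by (auto intro: word_rel.refl word_rel.sym word_rel.trans dest: word_rel_append)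
  then show ?thesis by (simp add: presented_group_def)
qed

text \<open>Peel the letters off from the left, appending the inverse of each one to the inverse word.\<close>
lemma word_left_inverse:
  assumes "w \<in> gwords X"
  shows "\<exists>v\<in>gwords X. (v @ w, []) \<in> word_rel X R"
  using assms
proof (induction w)
  case Nil
  then show ?case by (auto intro: word_rel.refl)
next
  case (Cons l w)
  obtain x b where l: "l = (x, b)" by (cases l)
  from Cons have w: "w \<in> gwords X" and x: "x \<in> X" by (auto simp: gwords_def l)
  with Cons.IH obtain v where v: "v \<in> gwords X" "(v @ w, []) \<in> word_rel X R" by auto
  have "((v @ [(x, \<not> b)]) @ l # w, v @ w) \<in> word_rel X R"
    using word_rel.cancel[OF v(1) w x, of "\<not> b" R] by (simp add: l)
  then have "((v @ [(x, \<not> b)]) @ l # w, []) \<in> word_rel X R" using v(2) by (rule word_rel.trans)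
  moreover have "v @ [(x, \<not> b)] \<in> gwords X" using v(1) x by (auto simp: gwords_def)
  ultimately show ?case by blast
qed

lemma group_presented_group: "group (presented_group X R)" (is "group ?G")
proof (rule groupI)
  fix a b c assume "a \<in> carrier ?G" "b \<in> carrier ?G" "c \<in> carrier ?G"
  then obtain u v w where "u \<in> gwords X" "v \<in> gwords X" "w \<in> gwords X"
    "a = word_class X R u" "b = word_class X R v" "c = word_class X R w"
    by (metis carrier_presented_group_cases)
  then show "a \<otimes>\<^bsub>?G\<^esub> b \<otimes>\<^bsub>?G\<^esub> c = a \<otimes>\<^bsub>?G\<^esub> (b \<otimes>\<^bsub>?G\<^esub> c)"
    by (simp add: mult_word_class gwords_def)
next
  fix a b assume "a \<in> carrier ?G" "b \<in> carrier ?G"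
  then obtain u v where "u \<in> gwords X" "v \<in> gwords X" "a = word_class X R u" "b = word_class X R v"
    by (metis carrier_presented_group_cases)
  then show "a \<otimes>\<^bsub>?G\<^esub> b \<in> carrier ?G"
    using word_class_in_carrier[of "u @ v" X R] by (simp add: mult_word_class gwords_def)
next
  show "\<one>\<^bsub>?G\<^esub> \<in> carrier ?G"
    by (simp add: one_presented_group word_class_in_carrier gwords_def)
next
  fix a assume "a \<in> carrier ?G"
  then obtain u where u: "u \<in> gwords X" "a = word_class X R u" by (rule carrier_presented_group_cases)
  have nil: "[] \<in> gwords X" by (simp add: gwords_def)
  show "\<one>\<^bsub>?G\<^esub> \<otimes>\<^bsub>?G\<^esub> a = a" using u nil by (simp add: one_presented_group mult_word_class)
  obtain v where v: "v \<in> gwords X" "(v @ u, []) \<in> word_rel X R" using word_left_inverse u by blast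
  moreover have "v @ u \<in> gwords X" using u v by (simp add: gwords_def)
  ultimately have "word_class X R v \<otimes>\<^bsub>?G\<^esub> a = \<one>\<^bsub>?G\<^esub>"
    using u nil by (simp add: one_presented_group mult_word_class word_class_eq_iff)
  then show "\<exists>b\<in>carrier ?G. b \<otimes>\<^bsub>?G\<^esub> a = \<one>\<^bsub>?G\<^esub>" using v word_class_in_carrier by blast
qed

abbreviation letter_class :: "'a set \<Rightarrow> ('a gword \<times> 'a gword) set \<Rightarrow> 'a \<Rightarrow> 'a gword set"
  where "letter_class X R x \<equiv> word_class X R [(x, True)]"

lemma letter_class_in_carrier:
  "x \<in> X \<Longrightarrow> letter_class X R x \<in> carrier (presented_group X R)"
  by (rule word_class_in_carrier) (simp add: gwords_def)

lemma letter_class_relation: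
  assumes "x \<in> X" "y \<in> X" "t \<in> X" "z \<in> X"
    and "([(x, True), (y, True)], [(t, True), (z, True)]) \<in> R"
  shows "letter_class X R x \<otimes>\<^bsub>presented_group X R\<^esub> letter_class X R y
    = letter_class X R t \<otimes>\<^bsub>presented_group X R\<^esub> letter_class X R z"
  using word_rel.relation[of "[]" X "[]" "[(x, True), (y, True)]" "[(t, True), (z, True)]" R] assms
  by (simp add: mult_word_class word_class_eq_iff gwords_def)

text \<open>The class of a negative letter is the inverse of the class of the positive one.\<close>
lemma generate_letter_classes:
  "generate (presented_group X R) (letter_class X R ` X) = carrier (presented_group X R)"
  (is "generate ?G ?Y = _")
proof
  interpret group ?G by (rule group_presented_group)
  show "generate ?G ?Y \<subseteq> carrier ?G" by (rule generate_incl) (auto simp: letter_class_in_carrier)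
  have "word_class X R w \<in> generate ?G ?Y" if "w \<in> gwords X" for w
    using that
  proof (induction w)
    case Nil
    then show ?case using generate.one[of ?G ?Y] by (simp add: one_presented_group)
  next
    case (Cons l w)
    obtain x b where l: "l = (x, b)" by (cases l)
    from Cons have w: "w \<in> gwords X" and x: "x \<in> X" by (auto simp: gwords_def l)
    have lw: "[(x, b)] \<in> gwords X" "[(x, True)] \<in> gwords X" "[(x, False)] \<in> gwords X" "[] \<in> gwords X"
      "[(x, False), (x, True)] \<in> gwords X" for b
      using x by (auto simp: gwords_def)
    have "word_class X R [(x, False)] = inv\<^bsub>?G\<^esub> letter_class X R x"
      using lw word_rel.cancel[of "[]" X "[]" x False R] x
      by (intro inv_equality[symmetric])
        (auto simp: mult_word_class one_presented_group word_class_eq_iff word_class_in_carrier)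
    then have "word_class X R [(x, b)] \<in> generate ?G ?Y"
      using x by (cases b) (auto intro: generate.incl generate.inv)
    then have "word_class X R [(x, b)] \<otimes>\<^bsub>?G\<^esub> word_class X R w \<in> generate ?G ?Y"
      using Cons.IH[OF w] by (rule generate.eng)
    then show ?case using w lw by (simp add: mult_word_class l)
  qed
  then show "carrier ?G \<subseteq> generate ?G ?Y" by (blast elim: carrier_presented_group_cases)
qed

text \<open>
  \<open>B x\<close> is the action of the inverse letter. It is a separate argument so that no inverse function
  has to be chosen.
\<close>
definition word_action :: "('a \<Rightarrow> 'c \<Rightarrow> 'c) \<Rightarrow> ('a \<Rightarrow> 'c \<Rightarrow> 'c) \<Rightarrow> 'a gword \<Rightarrow> 'c \<Rightarrow> 'c"
  where "word_action A B = foldr (\<lambda>(x, b). if b then A x else B x)"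

lemma word_action_simps [simp]:
  "word_action A B [] = id"
  "word_action A B ((x, True) # w) = A x \<circ> word_action A B w"
  "word_action A B ((x, False) # w) = B x \<circ> word_action A B w"
  "word_action A B (v @ w) = word_action A B v \<circ> word_action A B w"
  by (simp_all add: word_action_def fun_eq_iff)

text \<open>
  The universal property of a presentation, for actions: letters acting by invertible maps that
  satisfy the relations make the presented group act.
\<close>
lemma word_action_cong_word_rel:
  assumes "(u, v) \<in> word_rel X R"
    and "\<And>x. x \<in> X \<Longrightarrow> A x \<circ> B x = id" "\<And>x. x \<in> X \<Longrightarrow> B x \<circ> A x = id"
    and "\<And>r s. (r, s) \<in> R \<Longrightarrow> word_action A B r = word_action A B s"
  shows "word_action A B u = word_action A B v"
  using assms(1)
proof induction
  case (cancel u v x b)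
  then show ?case using assms(2,3) by (cases b) (simp_all add: fun_eq_iff)
next
  case (relation u v r s)
  then show ?case using assms(4) by simp
qed simp_all


section \<open>Groups with twisted coordinates\<close>

lemma list_prod_simps [simp]:
  "list_prod M [] = \<one>\<^bsub>M\<^esub>"
  "list_prod M (x # xs) = x \<otimes>\<^bsub>M\<^esub> list_prod M xs"
  by (simp_all add: list_prod_def)

text \<open>
  The assumptions on \<open>\<phi>\<close> say that it is the orbit map of the zero function for the action
  \<open>u \<mapsto> e\<^sub>y + u \<circ> \<delta>\<close> of the generators. Only the values of \<open>\<phi> a\<close> on \<open>Y\<close> matter. They may be
  negative, since inverses of generators act as well. Because \<open>\<phi>\<close> is a function of the group
  element, words in \<open>Y\<close> with different coordinates have different products in \<open>G\<close>.
\<close>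
locale twisted_coordinates = group G for G (structure) +
  fixes Y :: "'a set" and \<gamma> \<delta> :: "'a \<Rightarrow> 'a" and \<phi> :: "'a \<Rightarrow> 'a \<Rightarrow> int"
  assumes finite_Y: "finite Y"
    and Y_carrier: "Y \<subseteq> carrier G"
    and generate_Y: "generate G Y = carrier G"
    and \<gamma>_Y: "y \<in> Y \<Longrightarrow> \<gamma> y \<in> Y" and \<delta>_Y: "y \<in> Y \<Longrightarrow> \<delta> y \<in> Y"
    and \<gamma>_\<delta>: "y \<in> Y \<Longrightarrow> \<gamma> (\<delta> y) = y" and \<delta>_\<gamma>: "y \<in> Y \<Longrightarrow> \<delta> (\<gamma> y) = y"
    and exchange: "x \<in> Y \<Longrightarrow> y \<in> Y \<Longrightarrow> \<gamma> x \<otimes> y = \<gamma> y \<otimes> x"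
    and coord_one: "z \<in> Y \<Longrightarrow> \<phi> \<one> z = 0"
    and coord_gen_mult: "y \<in> Y \<Longrightarrow> b \<in> carrier G \<Longrightarrow> z \<in> Y
      \<Longrightarrow> \<phi> (y \<otimes> b) z = of_bool (z = y) + \<phi> b (\<delta> z)"
begin

definition pos :: "'a set"
  where "pos = {list_prod G xs | xs. set xs \<subseteq> Y}"

text \<open>A plain monoid record, whatever further fields the record of \<open>G\<close> may have.\<close>
definition pos_monoid :: "'a monoid"
  where "pos_monoid = \<lparr> carrier = pos, mult = (\<otimes>), one = \<one> \<rparr>"

definition deg :: "'a \<Rightarrow> nat"
  where "deg a = nat (\<Sum>y\<in>Y. \<phi> a y)"

lemma pos_monoid_simps [simp]:
  "carrier pos_monoid = pos" "mult pos_monoid = (\<otimes>)" "one pos_monoid = \<one>"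
  by (simp_all add: pos_monoid_def)

lemma list_prod_carrier [simp]: "set xs \<subseteq> Y \<Longrightarrow> list_prod G xs \<in> carrier G"
  using Y_carrier by (induction xs) auto

lemma pos_carrier: "a \<in> pos \<Longrightarrow> a \<in> carrier G"
  by (auto simp: pos_def)

lemma list_prod_pos [simp]: "set xs \<subseteq> Y \<Longrightarrow> list_prod G xs \<in> pos"
  by (auto simp: pos_def)

lemma one_pos: "\<one> \<in> pos"
  using list_prod_pos[of "[]"] by simp

lemma Y_pos: "y \<in> Y \<Longrightarrow> y \<in> pos"
  using list_prod_pos[of "[y]"] Y_carrier by auto

lemma list_prod_append:
  "set xs \<subseteq> Y \<Longrightarrow> set ys \<subseteq> Y \<Longrightarrow> list_prod G (xs @ ys) = list_prod G xs \<otimes> list_prod G ys"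
  using Y_carrier by (induction xs) (auto simp: m_assoc subset_iff)

lemma mult_pos: "a \<in> pos \<Longrightarrow> b \<in> pos \<Longrightarrow> a \<otimes> b \<in> pos"
proof -
  assume "a \<in> pos" "b \<in> pos"
  then obtain xs ys where "set xs \<subseteq> Y" "set ys \<subseteq> Y" "a = list_prod G xs" "b = list_prod G ys"
    by (auto simp: pos_def)
  then show ?thesis using list_prod_pos[of "xs @ ys"] by (simp add: list_prod_append)
qed

lemma \<delta>_bij: "bij_betw \<delta> Y Y"
  by (rule bij_betw_byWitness[where f' = \<gamma>]) (auto simp: \<gamma>_\<delta> \<delta>_\<gamma> \<gamma>_Y \<delta>_Y)

lemma \<gamma>_bij: "bij_betw \<gamma> Y Y"
  by (rule bij_betw_byWitness[where f' = \<delta>]) (auto simp: \<gamma>_\<delta> \<delta>_\<gamma> \<gamma>_Y \<delta>_Y)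

lemma \<delta>_pow_Y: "z \<in> Y \<Longrightarrow> (\<delta> ^^ n) z \<in> Y"
  by (induction n) (auto simp: \<delta>_Y)

lemma \<gamma>_pow_Y: "z \<in> Y \<Longrightarrow> (\<gamma> ^^ n) z \<in> Y"
  by (induction n) (auto simp: \<gamma>_Y)

lemma \<delta>_pow_\<gamma>_pow:
  assumes "z \<in> Y" "m \<le> n"
  shows "(\<delta> ^^ m) ((\<gamma> ^^ n) z) = (\<gamma> ^^ (n - m)) z"
  using assms(2)
proof (induction m)
  case (Suc m)
  then obtain k where k: "n - m = Suc k" "n - Suc m = k" by (metis Suc_diff_Suc Suc_le_lessD)
  then show ?case using Suc assms(1) by (simp add: \<delta>_\<gamma> \<gamma>_pow_Y)
qed simp

lemma \<gamma>_pow_\<delta>_pow: "z \<in> Y \<Longrightarrow> (\<gamma> ^^ n) ((\<delta> ^^ n) z) = z"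
  by (induction n) (simp_all add: \<gamma>_\<delta> \<delta>_pow_Y funpow_swap1[of \<gamma>])

lemma coord_list_prod_mult:
  assumes "set xs \<subseteq> Y" "b \<in> carrier G" "z \<in> Y"
  shows "\<phi> (list_prod G xs \<otimes> b) z = \<phi> (list_prod G xs) z + \<phi> b ((\<delta> ^^ length xs) z)"
  using assms
proof (induction xs arbitrary: z)
  case Nil
  then show ?case by (simp add: coord_one)
next
  case (Cons x xs)
  then have "x \<in> Y" "x \<in> carrier G" "set xs \<subseteq> Y" using Y_carrier by auto
  then show ?case using Cons
    by (simp add: m_assoc coord_gen_mult \<delta>_Y funpow_swap1)
qed

lemma coord_list_prod_nonneg: "set xs \<subseteq> Y \<Longrightarrow> z \<in> Y \<Longrightarrow> \<phi> (list_prod G xs) z \<ge> 0"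
  by (induction xs arbitrary: z) (auto simp: coord_one coord_gen_mult \<delta>_Y)

lemma coord_nonneg: "a \<in> pos \<Longrightarrow> z \<in> Y \<Longrightarrow> \<phi> a z \<ge> 0"
  by (auto simp: pos_def coord_list_prod_nonneg)

lemma sum_coord_list_prod: "set xs \<subseteq> Y \<Longrightarrow> (\<Sum>y\<in>Y. \<phi> (list_prod G xs) y) = int (length xs)"
proof (induction xs)
  case Nil
  then show ?case by (simp add: coord_one)
next
  case (Cons x xs)
  have "(\<Sum>y\<in>Y. \<phi> (list_prod G xs) (\<delta> y)) = (\<Sum>y\<in>Y. \<phi> (list_prod G xs) y)"
    by (rule sum.reindex_bij_betw[OF \<delta>_bij])
  moreover have "(\<Sum>y\<in>Y. of_bool (y = x)) = (1::int)"
    using Cons.prems finite_Y by (simp add: of_bool_def)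
  ultimately show ?case using Cons by (simp add: coord_gen_mult sum.distrib)
qed

lemma deg_list_prod [simp]: "set xs \<subseteq> Y \<Longrightarrow> deg (list_prod G xs) = length xs"
  by (simp add: deg_def sum_coord_list_prod)

lemma sum_coord: "a \<in> pos \<Longrightarrow> (\<Sum>y\<in>Y. \<phi> a y) = int (deg a)"
  by (auto simp: pos_def sum_coord_list_prod)

lemma coord_mult:
  "a \<in> pos \<Longrightarrow> b \<in> carrier G \<Longrightarrow> z \<in> Y \<Longrightarrow> \<phi> (a \<otimes> b) z = \<phi> a z + \<phi> b ((\<delta> ^^ deg a) z)"
  by (auto simp: pos_def coord_list_prod_mult)

lemma deg_mult: "a \<in> pos \<Longrightarrow> b \<in> pos \<Longrightarrow> deg (a \<otimes> b) = deg a + deg b"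
  by (auto simp: pos_def simp flip: list_prod_append)

lemma deg_one [simp]: "deg \<one> = 0"
  using deg_list_prod[of "[]"] by simp

lemma deg_eq_0_iff: "a \<in> pos \<Longrightarrow> deg a = 0 \<longleftrightarrow> a = \<one>"
  by (auto simp: pos_def)

lemma deg_Y: "y \<in> Y \<Longrightarrow> deg y = 1"
  using deg_list_prod[of "[y]"] Y_carrier by auto

lemma deg_cong: "(\<And>y. y \<in> Y \<Longrightarrow> \<phi> a y = \<phi> b y) \<Longrightarrow> deg a = deg b"
  by (simp add: deg_def)

text \<open>
  If \<open>y\<close> occurs in the coordinates of \<open>x \<cdot> w\<close> and is not \<open>x\<close>, then \<open>\<delta> y\<close> occurs in those of \<open>w\<close>
  and can be moved to the front of \<open>w\<close>; the exchange relation \<open>x \<cdot> \<delta> y = y \<cdot> \<delta> x\<close> then brings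
  \<open>y\<close> to the front of the whole word.
\<close>
lemma split_off_generator:
  assumes "set xs \<subseteq> Y" "y \<in> Y" "\<phi> (list_prod G xs) y > 0"
  shows "\<exists>ys. set ys \<subseteq> Y \<and> list_prod G xs = y \<otimes> list_prod G ys"
  using assms
proof (induction xs arbitrary: y)
  case Nil
  then show ?case by (simp add: coord_one)
next
  case (Cons x xs)
  show ?case
  proof (cases "x = y")
    case True
    with Cons.prems show ?thesis by auto
  next
    case False
    have x: "x \<in> Y" and xs: "set xs \<subseteq> Y" using Cons.prems by auto
    then have "\<phi> (list_prod G xs) (\<delta> y) > 0"
      using False Cons.prems by (simp add: coord_gen_mult)
    with Cons.IH[OF xs] obtain ys where ys: "set ys \<subseteq> Y" "list_prod G xs = \<delta> y \<otimes> list_prod G ys"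
      using Cons.prems(2) \<delta>_Y by blast
    have c: "x \<in> carrier G" "y \<in> carrier G" "\<delta> x \<in> carrier G" "\<delta> y \<in> carrier G"
      "list_prod G ys \<in> carrier G"
      using x Cons.prems(2) \<delta>_Y Y_carrier ys(1) by auto
    have "x \<otimes> \<delta> y = y \<otimes> \<delta> x"
      using exchange[of "\<delta> x" "\<delta> y"] x Cons.prems(2) by (simp add: \<delta>_Y \<gamma>_\<delta>)
    then have "list_prod G (x # xs) = y \<otimes> list_prod G (\<delta> x # ys)"
      using c by (simp add: ys(2) flip: m_assoc)
    moreover have "set (\<delta> x # ys) \<subseteq> Y" using ys(1) x \<delta>_Y by auto
    ultimately show ?thesis by blast
  qed
qed

text \<open>
  Faithfulness of the coordinates on positive elements: the first letter of one word can be split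
  off from the other, which shortens both.
\<close>
lemma list_prod_eqI:
  assumes "set xs \<subseteq> Y" "set ys \<subseteq> Y"
    and "\<And>z. z \<in> Y \<Longrightarrow> \<phi> (list_prod G xs) z = \<phi> (list_prod G ys) z"
  shows "list_prod G xs = list_prod G ys"
  using assms
proof (induction xs arbitrary: ys)
  case Nil
  then have "deg (list_prod G ys) = deg (list_prod G [])" by (intro deg_cong) simp
  with Nil show ?case by simp
next
  case (Cons x xs)
  then have x: "x \<in> Y" and xs: "set xs \<subseteq> Y" by auto
  then have "\<phi> (list_prod G (x # xs)) x > 0"
    by (simp add: coord_gen_mult coord_list_prod_nonneg \<delta>_Y add_pos_nonneg)
  then obtain zs where zs: "set zs \<subseteq> Y" "list_prod G ys = x \<otimes> list_prod G zs"
    using split_off_generator[OF Cons.prems(2) x] Cons.prems(3)[OF x] by auto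
  have "\<phi> (list_prod G xs) z = \<phi> (list_prod G zs) z" if "z \<in> Y" for z
    using Cons.prems(3)[of "\<gamma> z"] that x xs zs by (simp add: coord_gen_mult \<gamma>_Y \<delta>_\<gamma>)
  with Cons.IH[OF xs zs(1)] show ?case by (simp add: zs(2))
qed

lemma pos_eqI: "a \<in> pos \<Longrightarrow> b \<in> pos \<Longrightarrow> (\<And>z. z \<in> Y \<Longrightarrow> \<phi> a z = \<phi> b z) \<Longrightarrow> a = b"
  unfolding pos_def by (auto intro: list_prod_eqI)

lemma pos_with_coordinates:
  assumes "\<And>y. y \<in> Y \<Longrightarrow> u y \<ge> 0"
  shows "\<exists>a\<in>pos. \<forall>y\<in>Y. \<phi> a y = u y"
  using assms
proof (induction "nat (\<Sum>y\<in>Y. u y)" arbitrary: u)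
  case 0
  then have "(\<Sum>y\<in>Y. u y) = 0" by (simp add: order_antisym sum_nonneg)
  then have "\<forall>y\<in>Y. u y = 0" using 0 by (simp add: sum_nonneg_eq_0_iff finite_Y)
  then show ?case using one_pos coord_one by auto
next
  case (Suc n)
  then have "\<exists>y\<in>Y. u y \<noteq> 0" by (metis nat_0 old.nat.distinct(2) sum.neutral)
  then obtain y where y: "y \<in> Y" "u y > 0" using Suc.prems by force
  \<comment> \<open>the coordinates of the cofactor of \<open>y\<close>: solve \<open>u = e\<^sub>y + v \<circ> \<delta>\<close> for \<open>v\<close>\<close>
  define v where "v z = u (\<gamma> z) - of_bool (\<gamma> z = y)" for z
  have v: "v z \<ge> 0" if "z \<in> Y" for z using y Suc.prems[of "\<gamma> z"] \<gamma>_Y[OF that] by (auto simp: v_def)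
  have "(\<Sum>z\<in>Y. v z) = (\<Sum>z\<in>Y. u z - of_bool (z = y))"
    unfolding v_def by (rule sum.reindex_bij_betw[OF \<gamma>_bij])
  also have "\<dots> = (\<Sum>z\<in>Y. u z) - 1"
    using y finite_Y by (simp add: sum_subtractf of_bool_def)
  finally have "n = nat (\<Sum>z\<in>Y. v z)" using Suc.hyps(2) by linarith
  with Suc.hyps(1) v obtain a where a: "a \<in> pos" "\<forall>z\<in>Y. \<phi> a z = v z" by blast
  have "\<forall>z\<in>Y. \<phi> (y \<otimes> a) z = u z"
    using a y by (auto simp: coord_gen_mult pos_carrier \<delta>_Y v_def \<gamma>_\<delta>)
  moreover have "y \<otimes> a \<in> pos" using a y by (simp add: mult_pos Y_pos)
  ultimately show ?case by blast
qed

text \<open>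
  By \<open>coord_mult\<close>, the cofactor of \<open>a\<close> in \<open>c\<close> must have the coordinates of \<open>\<phi> c - \<phi> a\<close> shifted
  by \<open>deg a\<close>, and it exists as soon as these are nonnegative.
\<close>
lemma left_divisor_iff:
  assumes "a \<in> pos" "c \<in> pos"
  shows "left_divisor pos_monoid a c \<longleftrightarrow> (\<forall>y\<in>Y. \<phi> a y \<le> \<phi> c y)"
proof
  assume "left_divisor pos_monoid a c"
  then obtain t where "t \<in> pos" "c = a \<otimes> t" by (auto simp: left_divisor_def)
  then show "\<forall>y\<in>Y. \<phi> a y \<le> \<phi> c y"
    using assms by (auto simp: coord_mult pos_carrier coord_nonneg \<delta>_pow_Y)
next
  assume le: "\<forall>y\<in>Y. \<phi> a y \<le> \<phi> c y"
  define u where "u y = \<phi> c ((\<gamma> ^^ deg a) y) - \<phi> a ((\<gamma> ^^ deg a) y)" for y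
  have "u y \<ge> 0" if "y \<in> Y" for y using that le by (simp add: u_def \<gamma>_pow_Y)
  then obtain t where t: "t \<in> pos" "\<forall>y\<in>Y. \<phi> t y = u y" using pos_with_coordinates by blast
  have "c = a \<otimes> t"
    using assms t
    by (intro pos_eqI) (auto simp: mult_pos coord_mult pos_carrier \<delta>_pow_Y u_def \<gamma>_pow_\<delta>_pow)
  then show "left_divisor pos_monoid a c" using t by (auto simp: left_divisor_def)
qed

text \<open>
  Coordinates adapted to right divisibility. In \<open>\<phi> (t \<otimes> b)\<close> the coordinates of \<open>b\<close> appear shifted
  by \<open>deg t\<close>, which depends on the cofactor; undoing the total shift \<open>deg t + deg b\<close> leaves \<open>b\<close>
  with the shift \<open>deg b\<close>, which depends on \<open>b\<close> alone.
\<close>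
definition rcoord :: "'a \<Rightarrow> 'a \<Rightarrow> int"
  where "rcoord a y = \<phi> a ((\<gamma> ^^ deg a) y)"

lemma sum_pow_\<gamma>: "(\<Sum>y\<in>Y. u ((\<gamma> ^^ n) y)) = (\<Sum>y\<in>Y. u y)"
  using bij_betw_funpow[OF \<gamma>_bij, of n] by (rule sum.reindex_bij_betw)

lemma rcoord_mult:
  assumes "a \<in> pos" "b \<in> pos" "z \<in> Y"
  shows "rcoord (a \<otimes> b) z = \<phi> a ((\<gamma> ^^ (deg a + deg b)) z) + rcoord b z"
  using assms \<delta>_pow_\<gamma>_pow[of z "deg a" "deg a + deg b"]
  by (simp add: rcoord_def deg_mult coord_mult pos_carrier \<gamma>_pow_Y)

lemma rcoord_nonneg: "a \<in> pos \<Longrightarrow> z \<in> Y \<Longrightarrow> rcoord a z \<ge> 0"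
  by (simp add: rcoord_def coord_nonneg \<gamma>_pow_Y)

lemma sum_rcoord: "a \<in> pos \<Longrightarrow> (\<Sum>y\<in>Y. rcoord a y) = int (deg a)"
  by (simp add: rcoord_def sum_pow_\<gamma> sum_coord)

lemma pos_with_shifted_coordinates:
  assumes "\<And>y. y \<in> Y \<Longrightarrow> u y \<ge> 0"
  shows "\<exists>a\<in>pos. int (deg a) = (\<Sum>y\<in>Y. u y) \<and> (\<forall>y\<in>Y. \<phi> a ((\<gamma> ^^ n) y) = u y)"
proof -
  obtain a where a: "a \<in> pos" "\<forall>y\<in>Y. \<phi> a y = u ((\<delta> ^^ n) y)"
    using pos_with_coordinates[of "\<lambda>y. u ((\<delta> ^^ n) y)"] assms \<delta>_pow_Y by auto
  have eq: "\<forall>y\<in>Y. \<phi> a ((\<gamma> ^^ n) y) = u y"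
    using a by (simp add: \<gamma>_pow_Y \<delta>_pow_\<gamma>_pow)
  have "int (deg a) = (\<Sum>y\<in>Y. \<phi> a ((\<gamma> ^^ n) y))" using a(1) sum_pow_\<gamma>[of "\<phi> a" n] by (simp add: sum_coord)
  then show ?thesis using a eq by auto
qed

text \<open>
  The shift in \<open>rcoord\<close> is the degree of the element that is sought, but this degree can be read
  off in advance as the sum of the prescribed values.
\<close>
lemma pos_with_rcoord:
  assumes "\<And>y. y \<in> Y \<Longrightarrow> u y \<ge> 0"
  shows "\<exists>a\<in>pos. \<forall>y\<in>Y. rcoord a y = u y"
  using pos_with_shifted_coordinates[where u = u and n = "nat (\<Sum>y\<in>Y. u y)"] assms
  by (metis nat_int rcoord_def)

lemma pos_eqI_rcoord:
  assumes "a \<in> pos" "b \<in> pos" "\<And>z. z \<in> Y \<Longrightarrow> rcoord a z = rcoord b z"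
  shows "a = b"
proof (rule pos_eqI)
  fix z assume z: "z \<in> Y"
  have "int (deg a) = int (deg b)" using assms by (simp flip: sum_rcoord)
  then show "\<phi> a z = \<phi> b z"
    using assms(3)[OF \<delta>_pow_Y[OF z, of "deg a"]] z by (simp add: rcoord_def \<gamma>_pow_\<delta>_pow)
qed (use assms in auto)

lemma right_divisor_iff:
  assumes "b \<in> pos" "c \<in> pos"
  shows "right_divisor pos_monoid b c \<longleftrightarrow> (\<forall>y\<in>Y. rcoord b y \<le> rcoord c y)"
proof
  assume "right_divisor pos_monoid b c"
  then obtain t where "t \<in> pos" "c = t \<otimes> b" by (auto simp: right_divisor_def)
  then show "\<forall>y\<in>Y. rcoord b y \<le> rcoord c y"
    using assms by (auto simp: rcoord_mult coord_nonneg \<gamma>_pow_Y)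
next
  assume "\<forall>y\<in>Y. rcoord b y \<le> rcoord c y"
  then obtain t where t: "t \<in> pos" "int (deg t) = (\<Sum>y\<in>Y. rcoord c y - rcoord b y)"
    "\<forall>y\<in>Y. \<phi> t ((\<gamma> ^^ deg c) y) = rcoord c y - rcoord b y"
    using pos_with_shifted_coordinates[where u = "\<lambda>y. rcoord c y - rcoord b y" and n = "deg c"]
    by auto
  have "int (deg t) = int (deg c) - int (deg b)"
    using t(2) assms by (simp add: sum_subtractf sum_rcoord)
  then have "deg t + deg b = deg c" by linarith
  then have "c = t \<otimes> b"
    using assms t by (intro pos_eqI_rcoord) (auto simp: mult_pos rcoord_mult)
  then show "right_divisor pos_monoid b c" using t by (auto simp: right_divisor_def)
qed

text \<open>
  Any relation that is the pointwise order of coordinates taking all nonnegative values has meets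
  and joins. It is applied to left and to right divisibility.
\<close>
lemma meet_join_of_coordinates:
  fixes \<psi> :: "'a \<Rightarrow> 'a \<Rightarrow> int"
  assumes nonneg: "\<And>a y. a \<in> pos \<Longrightarrow> y \<in> Y \<Longrightarrow> \<psi> a y \<ge> 0"
    and surj: "\<And>u. (\<And>y. y \<in> Y \<Longrightarrow> u y \<ge> 0) \<Longrightarrow> \<exists>a\<in>pos. \<forall>y\<in>Y. \<psi> a y = u y"
    and D: "\<And>a c. a \<in> pos \<Longrightarrow> c \<in> pos \<Longrightarrow> D a c \<longleftrightarrow> (\<forall>y\<in>Y. \<psi> a y \<le> \<psi> c y)"
    and "a \<in> pos" "b \<in> pos"
  shows "\<exists>d\<in>pos. D d a \<and> D d b \<and> (\<forall>e\<in>pos. D e a \<and> D e b \<longrightarrow> D e d)"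
    and "\<exists>m\<in>pos. D a m \<and> D b m \<and> (\<forall>n\<in>pos. D a n \<and> D b n \<longrightarrow> D m n)"
proof -
  obtain d where "d \<in> pos" "\<forall>y\<in>Y. \<psi> d y = min (\<psi> a y) (\<psi> b y)"
    using surj[of "\<lambda>y. min (\<psi> a y) (\<psi> b y)"] nonneg assms(4,5) by auto
  then show "\<exists>d\<in>pos. D d a \<and> D d b \<and> (\<forall>e\<in>pos. D e a \<and> D e b \<longrightarrow> D e d)"
    using assms(4,5) by (intro bexI[of _ d]) (auto simp: D)
  obtain m where "m \<in> pos" "\<forall>y\<in>Y. \<psi> m y = max (\<psi> a y) (\<psi> b y)"
    using surj[of "\<lambda>y. max (\<psi> a y) (\<psi> b y)"] nonneg assms(4,5) by (auto simp: le_max_iff_disj)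
  then show "\<exists>m\<in>pos. D a m \<and> D b m \<and> (\<forall>n\<in>pos. D a n \<and> D b n \<longrightarrow> D m n)"
    using assms(4,5) by (intro bexI[of _ m]) (auto simp: D)
qed

lemma gcds_and_lcms:
  assumes "a \<in> pos" "b \<in> pos"
  shows "\<exists>d. is_left_gcd pos_monoid d a b" "\<exists>m. is_right_lcm pos_monoid m a b"
    "\<exists>d. is_right_gcd pos_monoid d a b" "\<exists>m. is_left_lcm pos_monoid m a b"
  using meet_join_of_coordinates[of \<phi> "left_divisor pos_monoid", OF coord_nonneg
      pos_with_coordinates left_divisor_iff assms]
    meet_join_of_coordinates[of rcoord "right_divisor pos_monoid", OF rcoord_nonneg
      pos_with_rcoord right_divisor_iff assms]
  by (auto simp: is_left_gcd_def is_right_lcm_def is_right_gcd_def is_left_lcm_def)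

lemma monoid_pos: "monoid pos_monoid"
  by (rule monoidI) (auto simp: one_pos mult_pos pos_carrier m_assoc)

lemma list_prod_pos_monoid: "list_prod pos_monoid xs = list_prod G xs"
  by (simp add: list_prod_def)

lemma pos_generated: "monoid_generated_by pos_monoid Y"
  by (auto simp: monoid_generated_by_def list_prod_pos_monoid Y_pos) (auto simp: pos_def)

text \<open>The degree is additive, and the generators are the elements of degree 1.\<close>
lemma atoms_pos: "atoms pos_monoid = Y"
proof
  show "Y \<subseteq> atoms pos_monoid"
  proof
    fix y assume y: "y \<in> Y"
    have "y \<noteq> \<one>" using y deg_eq_0_iff[OF Y_pos[OF y]] by (simp add: deg_Y)
    moreover have "a = \<one> \<or> b = \<one>" if "a \<in> pos" "b \<in> pos" "y = a \<otimes> b" for a b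
    proof -
      have "deg a + deg b = 1" using that y by (metis deg_mult deg_Y)
      then have "deg a = 0 \<or> deg b = 0" by linarith
      then show ?thesis using that by (auto simp: deg_eq_0_iff)
    qed
    ultimately show "y \<in> atoms pos_monoid" using y by (auto simp: atoms_def Y_pos)
  qed
  show "atoms pos_monoid \<subseteq> Y"
  proof
    fix a assume a: "a \<in> atoms pos_monoid"
    then obtain xs where xs: "set xs \<subseteq> Y" "a = list_prod G xs" by (auto simp: atoms_def pos_def)
    moreover have "a \<noteq> \<one>" using a by (simp add: atoms_def)
    ultimately obtain y ys where y: "y \<in> Y" "set ys \<subseteq> Y" "a = y \<otimes> list_prod G ys"
      by (cases xs) auto
    then have "y = \<one> \<or> list_prod G ys = \<one>" using a by (auto simp: atoms_def Y_pos)
    moreover have "y \<noteq> \<one>" using y(1) deg_eq_0_iff[OF Y_pos[OF y(1)]] by (simp add: deg_Y)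
    ultimately show "a \<in> Y" using y Y_carrier by auto
  qed
qed

lemma gaussian_pos: "gaussian_monoid pos_monoid"
proof -
  have "bdd_above {length xs | xs. set xs \<subseteq> Y \<and> list_prod G xs = a}" for a
    by (rule bdd_aboveI[of _ "deg a"]) auto
  then have "atomic_monoid pos_monoid"
    by (simp add: atomic_monoid_def atoms_pos monoid_pos pos_generated list_prod_pos_monoid)
  moreover have "monoid_cancel pos_monoid"
    by (rule monoid.monoid_cancelI[OF monoid_pos]) (simp_all add: pos_carrier)
  ultimately show ?thesis by (simp add: gaussian_monoid_def gcds_and_lcms)
qed

text \<open>
  The constant function 1 is fixed by every permutation of \<open>Y\<close>, so being bounded by it means the
  same for \<open>\<phi>\<close> and for \<open>rcoord\<close>.
\<close>
lemma garside_pos: "garside_monoid pos_monoid"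
proof -
  obtain \<Delta> where \<Delta>: "\<Delta> \<in> pos" "\<forall>y\<in>Y. \<phi> \<Delta> y = 1"
    using pos_with_coordinates[of "\<lambda>_. 1"] by auto
  let ?D = "{a \<in> pos. \<forall>y\<in>Y. \<phi> a y \<le> 1}"
  have left: "{a \<in> pos. left_divisor pos_monoid a \<Delta>} = ?D"
    using \<Delta> by (auto simp: left_divisor_iff)
  have "(\<forall>y\<in>Y. rcoord a y \<le> 1) \<longleftrightarrow> (\<forall>y\<in>Y. \<phi> a y \<le> 1)" for a
    unfolding rcoord_def by (metis \<delta>_pow_Y \<gamma>_pow_Y \<gamma>_pow_\<delta>_pow)
  then have right: "{a \<in> pos. right_divisor pos_monoid a \<Delta>} = ?D"
    using \<Delta> by (auto simp: right_divisor_iff rcoord_def[of \<Delta>] \<gamma>_pow_Y)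
  have inj: "inj_on (\<lambda>a. restrict (\<phi> a) Y) ?D"
  proof (rule inj_onI, rule pos_eqI)
    fix a b z assume eq: "restrict (\<phi> a) Y = restrict (\<phi> b) Y" and z: "z \<in> Y"
    show "\<phi> a z = \<phi> b z" using fun_cong[OF eq, of z] z by simp
  qed auto
  have "(\<lambda>a. restrict (\<phi> a) Y) ` ?D \<subseteq> Y \<rightarrow>\<^sub>E {0..1}" by (auto simp: coord_nonneg)
  moreover have "finite (Y \<rightarrow>\<^sub>E {0..1::int})" by (intro finite_PiE finite_Y) simp
  ultimately have "finite ?D" by (rule inj_on_finite[OF inj])
  moreover have "\<phi> y z \<le> 1" if "y \<in> Y" "z \<in> Y" for y z
    using coord_gen_mult[of y \<one> z] that Y_carrier by (auto simp: coord_one \<delta>_Y)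
  then have "Y \<subseteq> ?D" by (auto simp: Y_pos)
  then have "monoid_generated_by pos_monoid ?D"
    using pos_generated unfolding monoid_generated_by_def by simp (meson subset_trans)
  ultimately have "garside_element pos_monoid \<Delta>"
    using \<Delta> by (simp add: garside_element_def left right)
  then show ?thesis using gaussian_pos by (auto simp: garside_monoid_def)
qed

lemma common_left_multiple:
  assumes "a \<in> pos" "b \<in> pos"
  obtains s t where "s \<in> pos" "t \<in> pos" "s \<otimes> a = t \<otimes> b"
  using gcds_and_lcms(4)[OF assms] by (auto simp: is_left_lcm_def right_divisor_def)

text \<open>
  Fractions are closed under products by Ore's argument: if \<open>s \<otimes> b = t \<otimes> c\<close>, then
  \<open>b \<otimes> inv c = inv s \<otimes> t\<close>, so the two inner factors of \<open>inv a \<otimes> b \<otimes> inv c \<otimes> d\<close> can be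
  exchanged.
\<close>
lemma left_fraction:
  assumes "z \<in> carrier G"
  shows "\<exists>a\<in>pos. \<exists>b\<in>pos. z = inv a \<otimes> b"
proof -
  from assms have "z \<in> generate G Y" by (simp add: generate_Y)
  then show ?thesis
  proof induction
    case one
    then show ?case using one_pos by (metis inv_one l_one one_closed)
  next
    case (incl h)
    then show ?case using one_pos Y_pos by (metis inv_one l_one pos_carrier)
  next
    case (inv h)
    then show ?case using one_pos Y_pos by (metis inv_closed r_one pos_carrier)
  next
    case (eng h1 h2)
    then obtain a b c d where p: "a \<in> pos" "b \<in> pos" "c \<in> pos" "d \<in> pos"
      and h: "h1 = inv a \<otimes> b" "h2 = inv c \<otimes> d" by blast
    obtain s t where st: "s \<in> pos" "t \<in> pos" "s \<otimes> b = t \<otimes> c"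
      using p(2,3) by (rule common_left_multiple)
    note carr = p[THEN pos_carrier] st(1,2)[THEN pos_carrier]
    have "b \<otimes> inv c = inv s \<otimes> t"
      using carr st(3) by (metis inv_closed inv_solve_left inv_solve_right m_assoc m_closed)
    then have "h1 \<otimes> h2 = inv a \<otimes> (inv s \<otimes> t) \<otimes> d"
      using carr by (simp add: h m_assoc[symmetric]) (simp add: m_assoc)
    also have "\<dots> = inv (s \<otimes> a) \<otimes> (t \<otimes> d)"
      using carr by (simp add: inv_mult_group m_assoc)
    finally show ?case using p st by (blast intro: mult_pos)
  qed
qed

theorem garside_group: "garside_group G"
proof -
  have "group_of_fractions pos_monoid G id"
    using left_fraction
    by (simp add: group_of_fractions_def monoid_pos group_axioms hom_def Pi_def pos_carrier)
  then show ?thesis using garside_pos by (auto simp: garside_group_def)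
qed

end


section \<open>The structure group of a permutation solution\<close>

theorem theorem9p7:
  fixes X :: "'a set"
    and f g :: "'a \<Rightarrow> 'a"
    and S :: "'a \<times> 'a \<Rightarrow> 'a \<times> 'a"
  assumes "finite X" and "X \<noteq> {}"
    and "bij_betw f X X" and "bij_betw g X X"
    and "\<forall>x\<in>X. f (g x) = g (f x)"
    and "\<forall>x\<in>X. \<forall>y\<in>X. S (x, y) = (g y, f x)"
  shows "garside_group (structure_group X S)"
proof -
  define R where "R = {([(x, True), (y, True)], [(t, True), (z, True)]) | x y t z.
       x \<in> X \<and> y \<in> X \<and> S (x, y) = (t, z)}"
  define G where "G = presented_group X R"
  define \<iota> where "\<iota> = letter_class X R"
  define Y where "Y = \<iota> ` X"
  interpret G: group G by (simp add: G_def group_presented_group)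
  have fX: "f x \<in> X" and gX: "g x \<in> X" if "x \<in> X" for x
    using that assms(3,4) by (auto dest: bij_betwE)
  have \<iota>_carrier [simp]: "\<iota> x \<in> carrier G" if "x \<in> X" for x
    using that by (simp add: \<iota>_def G_def letter_class_in_carrier)
  have rel: "\<iota> x \<otimes>\<^bsub>G\<^esub> \<iota> y = \<iota> (g y) \<otimes>\<^bsub>G\<^esub> \<iota> (f x)" if "x \<in> X" "y \<in> X" for x y
    unfolding \<iota>_def G_def
    by (rule letter_class_relation) (use that assms(6) in \<open>auto simp: R_def fX gX\<close>)
  \<comment> \<open>cancel \<open>\<iota> (g x)\<close> in the relation for the pair \<open>(g x, x)\<close>\<close>
  have fg: "\<iota> (f (g x)) = \<iota> x" if "x \<in> X" for x
    using rel[of "g x" x] that by (simp add: fX gX)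
  have gf: "\<iota> (g (f x)) = \<iota> x" if "x \<in> X" for x
    using fg[OF that] assms(5) that by simp
  \<comment> \<open>distinct letters may name the same group element, so \<open>f\<close> and \<open>g\<close> must be shown to descend\<close>
  have g_cong: "\<iota> (g x) = \<iota> (g y)" if "\<iota> x = \<iota> y" "x \<in> X" "y \<in> X" for x y
    using rel[of x x] rel[of x y] that by (simp add: fX gX)
  have f_cong: "\<iota> (f x) = \<iota> (f y)" if "\<iota> x = \<iota> y" "x \<in> X" "y \<in> X" for x y
    using rel[of x x] rel[of y x] that by (simp add: fX gX)
  \<comment> \<open>extended by the identity outside \<open>Y\<close>, which makes them inverse to each other everywhere and
    the maps \<open>A x\<close> and \<open>B x\<close> below invertible on all functions\<close>
  define \<gamma> where "\<gamma> p = (if p \<in> Y then \<iota> (g (inv_into X \<iota> p)) else p)" for p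
  define \<delta> where "\<delta> p = (if p \<in> Y then \<iota> (f (inv_into X \<iota> p)) else p)" for p
  have \<gamma>_\<iota>: "\<gamma> (\<iota> x) = \<iota> (g x)" if "x \<in> X" for x
    using g_cong[of "inv_into X \<iota> (\<iota> x)" x] that by (simp add: \<gamma>_def Y_def f_inv_into_f inv_into_into)
  have \<delta>_\<iota>: "\<delta> (\<iota> x) = \<iota> (f x)" if "x \<in> X" for x
    using f_cong[of "inv_into X \<iota> (\<iota> x)" x] that by (simp add: \<delta>_def Y_def f_inv_into_f inv_into_into)
  have \<gamma>_\<delta>: "\<gamma> (\<delta> p) = p" for p
    by (cases "p \<in> Y") (auto simp: Y_def \<gamma>_\<iota> \<delta>_\<iota> fX gf, auto simp: \<gamma>_def \<delta>_def Y_def)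
  have \<delta>_\<gamma>: "\<delta> (\<gamma> p) = p" for p
    by (cases "p \<in> Y") (auto simp: Y_def \<gamma>_\<iota> \<delta>_\<iota> gX fg, auto simp: \<gamma>_def \<delta>_def Y_def)
  define A where "A x u p = of_bool (p = \<iota> x) + u (\<delta> p)" for x and u :: "'a gword set \<Rightarrow> int" and p
  define B where "B x u p = u (\<gamma> p) - of_bool (\<gamma> p = \<iota> x)" for x and u :: "'a gword set \<Rightarrow> int" and p
  have act: "word_action A B u = word_action A B v" if "(u, v) \<in> word_rel X R" for u v
    using that
  proof (rule word_action_cong_word_rel)
    show "A x \<circ> B x = id" "B x \<circ> A x = id" for x
      by (auto simp: A_def B_def fun_eq_iff \<gamma>_\<delta> \<delta>_\<gamma>)
    fix r s assume "(r, s) \<in> R"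
    then obtain x y where xy: "x \<in> X" "y \<in> X"
      "r = [(x, True), (y, True)]" "s = [(g y, True), (f x, True)]"
      using assms(6) by (auto simp: R_def)
    have "\<delta> p = \<iota> y \<longleftrightarrow> p = \<iota> (g y)" "\<delta> p = \<iota> (f x) \<longleftrightarrow> p = \<iota> x" for p
      using xy(1,2) by (metis \<gamma>_\<delta> \<delta>_\<gamma> \<gamma>_\<iota>, metis \<gamma>_\<delta> \<delta>_\<iota>)
    then show "word_action A B r = word_action A B s"
      by (auto simp: xy A_def fun_eq_iff)
  qed
  define \<phi> where "\<phi> a = word_action A B (SOME w. w \<in> gwords X \<and> a = word_class X R w) (\<lambda>_. 0)" for a
  have \<phi>: "\<phi> (word_class X R w) = word_action A B w (\<lambda>_. 0)" if "w \<in> gwords X" for w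
  proof -
    define v where "v = (SOME v. v \<in> gwords X \<and> word_class X R w = word_class X R v)"
    have "v \<in> gwords X \<and> word_class X R w = word_class X R v"
      unfolding v_def by (rule someI[of _ w]) (use that in simp)
    then have "(w, v) \<in> word_rel X R" using word_class_eq_iff that by blast
    then show ?thesis using act[of w v] by (simp only: \<phi>_def flip: v_def)
  qed
  have "twisted_coordinates G Y \<gamma> \<delta> \<phi>"
  proof unfold_locales
    show "finite Y" using assms(1) by (simp add: Y_def)
    show "Y \<subseteq> carrier G" by (auto simp: Y_def)
    show "generate G Y = carrier G"
      by (simp add: G_def Y_def \<iota>_def generate_letter_classes)
    show "\<gamma> y \<in> Y" "\<delta> y \<in> Y" if "y \<in> Y" for y using that by (auto simp: Y_def \<gamma>_\<iota> \<delta>_\<iota> fX gX)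
    show "\<gamma> x \<otimes>\<^bsub>G\<^esub> y = \<gamma> y \<otimes>\<^bsub>G\<^esub> x" if xy: "x \<in> Y" "y \<in> Y" for x y
    proof -
      obtain a b where "a \<in> X" "b \<in> X" "x = \<iota> a" "y = \<iota> b"
        using xy by (auto simp: Y_def)
      then show ?thesis using rel[of "g a" b] by (simp add: \<gamma>_\<iota> gX fg)
    qed
    show "\<phi> \<one>\<^bsub>G\<^esub> z = 0" for z
      using \<phi>[of "[]"] by (simp add: G_def one_presented_group gwords_def)
    show "\<phi> (y \<otimes>\<^bsub>G\<^esub> b) z = of_bool (z = y) + \<phi> b (\<delta> z)"
      if y: "y \<in> Y" and b: "b \<in> carrier G" for y b z
    proof -
      obtain x where x: "x \<in> X" "y = \<iota> x" using y by (auto simp: Y_def)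
      obtain w where w: "w \<in> gwords X" "b = word_class X R w"
        using b unfolding G_def by (rule carrier_presented_group_cases)
      have l: "[(x, True)] \<in> gwords X" "(x, True) # w \<in> gwords X" using x w by (auto simp: gwords_def)
      have "y \<otimes>\<^bsub>G\<^esub> b = word_class X R ((x, True) # w)"
        using mult_word_class[OF l(1) w(1)] by (simp add: x w \<iota>_def G_def)
      then have "\<phi> (y \<otimes>\<^bsub>G\<^esub> b) = A x (\<phi> b)" using w \<phi>[OF l(2)] \<phi>[OF w(1)] by simp
      then show ?thesis by (simp only: A_def x)
    qed
  qed (simp_all add: \<gamma>_\<delta> \<delta>_\<gamma>)
  then have "garside_group G" by (rule twisted_coordinates.garside_group)
  then show ?thesis by (simp add: structure_group_def G_def R_def)
qed

end
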